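(* Let $T=\{1,\dots,m\}$, let $a_t\in\mathbb{R}^n$ ($t\in T$) and $c_1,\dots,c_q\in\mathbb{R}^n$ be fixed, and let $\mathcal{F}$, $\mathcal{S}$, $\mathcal{P}$ be the feasible set, nondominated solution and Pareto front mappings of the parameterized linear multiobjective problem (see context). Let $(\overline{b},\overline{x})\in\mathrm{gph}\,\mathcal{S}$ and let $\overline{p}=(\langle c_1,\overline{x}\rangle,\dots,\langle c_q,\overline{x}\rangle)\in\mathcal{P}(\overline{b})$. Then $$\partial\mathcal{F}(\overline{b},\overline{x})=\bigcup_{\alpha\in\mathbb{R}^q_+,\ \left\|\sum_{i=1}^q\alpha_ic_i\right\|_*=1}\Big\{y\in\mathbb{R}^T\ \Big|\ \langle y,b-\overline{b}\rangle\le\langle\alpha,p-\overline{p}\rangle\ \text{ for all }(b,p)\in\mathrm{gph}\,\mathcal{P}\Big\}.$$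
   Context: $\mathbb{R}^n$ carries an arbitrary norm with dual norm $\|\cdot\|_*$; $\mathbb{R}^T$ carries the supremum norm. For $b=(b_t)_{t\in T}\in\mathbb{R}^T$: $\mathcal{F}(b):=\{x\in\mathbb{R}^n:\langle a_t,x\rangle\le b_t,\ t\in T\}$. $\mathcal{S}(b)$ is the set of all $x\in\mathcal{F}(b)$ for which there is no $y\in\mathcal{F}(b)$ with $\langle c_i,y\rangle\le\langle c_i,x\rangle$ for all $i=1,\dots,q$ and $\langle c_{i_0},y\rangle<\langle c_{i_0},x\rangle$ for some $i_0$. $\mathcal{P}(b):=\{(\langle c_1,x\rangle,\dots,\langle c_q,x\rangle): x\in\mathcal{S}(b)\}\subset\mathbb{R}^q$. $\mathbb{R}^q_+$ is the set of vectors with nonnegative components. For $\Omega\subset\mathbb{R}^n$, $\Omega^\circ:=\{y\in\mathbb{R}^n:\langle y,x\rangle\ge0\ \text{for all }x\in\Omega\}$. $\mathcal{E}_{\mathcal{F}}(b):=\mathcal{F}(b)+\Theta$ with $\Theta:=\{c_1,\dots,c_q\}^\circ$. The graph of a set-valued mapping $\mathcal{M}$ is $\mathrm{gph}\,\mathcal{M}=\{(y,z): z\in\mathcal{M}(y)\}$. For a convex set $\Omega$ and $\overline{w}\in\Omega$, $N(\overline{w};\Omega)=\{w^*:\langle w^*,w-\overline{w}\rangle\le0\ \forall w\in\Omega\}$. For $\mathcal{M}$ with convex graph, $y^*\in D^*\mathcal{M}(\overline{y},\overline{z})(z^* )\iff(y^*,-z^* )\in N((\overline{y},\overline{z});\mathrm{gph}\,\mathcal{M})$.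 The graph of $\mathcal{E}_{\mathcal{F}}$ is convex, and the subdifferential of $\mathcal{F}$ (with ordering cone $\Theta$) is $$\partial\mathcal{F}(\overline{b},\overline{x}):=\{y: y\in D^*\mathcal{E}_{\mathcal{F}}(\overline{b},\overline{x})(z^* )\ \text{for some } z^*\in\mathbb{R}^n\text{ with }-z^*\in N(0_n;\Theta),\ \|z^*\|_*=1\}.$$ *)

theory Defs
  imports "HOL-Analysis.Analysis"
begin

text \<open>The index sets \<open>{1..n}\<close>, \<open>T = {1..m}\<close> and \<open>{1..q}\<close> are rendered by the finite types
  \<open>'n\<close>, \<open>'m\<close> and \<open>'q\<close>.  The pairing on every space is the canonical inner product; on a product
  it is the sum of the componentwise inner products.\<close>

definition is_norm :: "('a::real_vector \<Rightarrow> real) \<Rightarrow> bool" where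
  "is_norm N \<longleftrightarrow>
     (\<forall>x. 0 \<le> N x) \<and> (\<forall>x. N x = 0 \<longleftrightarrow> x = 0) \<and>
     (\<forall>r x. N (r *\<^sub>R x) = \<bar>r\<bar> * N x) \<and> (\<forall>x y. N (x + y) \<le> N x + N y)"

definition dual_norm :: "('a::real_inner \<Rightarrow> real) \<Rightarrow> 'a \<Rightarrow> real" where
  "dual_norm N z = (SUP x\<in>{x. N x \<le> 1}. \<bar>z \<bullet> x\<bar>)"

definition gph :: "('a \<Rightarrow> 'b set) \<Rightarrow> ('a \<times> 'b) set" where
  "gph M = {(y, z). z \<in> M y}"

text \<open>The next two notions are meant for convex \<open>\<Omega>\<close> with \<open>w \<in> \<Omega>\<close>, respectively for \<open>(y, z)\<close> in the
  convex graph of \<open>M\<close>.\<close>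

definition normal_cone :: "'a::real_inner \<Rightarrow> 'a set \<Rightarrow> 'a set" where
  "normal_cone w \<Omega> = {w'. \<forall>v\<in>\<Omega>. w' \<bullet> (v - w) \<le> 0}"

definition coderivative ::
    "('a::real_inner \<Rightarrow> 'b::real_inner set) \<Rightarrow> 'a \<Rightarrow> 'b \<Rightarrow> 'b \<Rightarrow> 'a set" where
  "coderivative M y z z' = {y'. (y', - z') \<in> normal_cone (y, z) (gph M)}"

definition positive_polar :: "'a::real_inner set \<Rightarrow> 'a set" where
  "positive_polar \<Omega> = {y. \<forall>x\<in>\<Omega>. 0 \<le> y \<bullet> x}"

text \<open>The sum of two sets is the Minkowski sum.\<close>

definition epi_map :: "'b set \<Rightarrow> ('a \<Rightarrow> 'b::real_inner set) \<Rightarrow> 'a \<Rightarrow> 'b set" where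
  "epi_map \<Theta> M y = M y + \<Theta>"

definition subdifferential ::
    "('b \<Rightarrow> real) \<Rightarrow> 'b set \<Rightarrow> ('a::real_inner \<Rightarrow> 'b::real_inner set) \<Rightarrow> 'a \<Rightarrow> 'b \<Rightarrow> 'a set" where
  "subdifferential N \<Theta> M y z =
     {y'. \<exists>z'. y' \<in> coderivative (epi_map \<Theta> M) y z z' \<and>
               - z' \<in> normal_cone 0 \<Theta> \<and> dual_norm N z' = 1}"

definition feasible_set :: "('m::finite \<Rightarrow> real^'n) \<Rightarrow> real^'m \<Rightarrow> (real^'n) set" where
  "feasible_set a b = {x. \<forall>t. a t \<bullet> x \<le> b $ t}"

definition nondominated_set ::
    "('m::finite \<Rightarrow> real^'n) \<Rightarrow> ('q::finite \<Rightarrow> real^'n) \<Rightarrow> real^'m \<Rightarrow> (real^'n) set" where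
  "nondominated_set a c b =
     {x \<in> feasible_set a b.
        \<not> (\<exists>y\<in>feasible_set a b.
              (\<forall>i. c i \<bullet> y \<le> c i \<bullet> x) \<and> (\<exists>i\<^sub>0. c i\<^sub>0 \<bullet> y < c i\<^sub>0 \<bullet> x))}"

definition objective_vec :: "('q::finite \<Rightarrow> real^'n) \<Rightarrow> real^'n \<Rightarrow> real^'q" where
  "objective_vec c x = (\<chi> i. c i \<bullet> x)"

definition pareto_front ::
    "('m::finite \<Rightarrow> real^'n) \<Rightarrow> ('q::finite \<Rightarrow> real^'n) \<Rightarrow> real^'m \<Rightarrow> (real^'q) set" where
  "pareto_front a c b = objective_vec c ` nondominated_set a c b"

definition ordering_cone :: "('q::finite \<Rightarrow> real^'n) \<Rightarrow> (real^'n) set" where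
  "ordering_cone c = positive_polar (range c)"

lemma convex_gph_epi_feasible:
  fixes a :: "'m::finite \<Rightarrow> real^'n" and c :: "'q::finite \<Rightarrow> real^'n"
  shows "convex (gph (epi_map (ordering_cone c) (feasible_set a)))"
proof (rule convexI)
  fix v w :: "(real^'m) \<times> (real^'n)" and s r :: real
  assume v: "v \<in> gph (epi_map (ordering_cone c) (feasible_set a))"
    and w: "w \<in> gph (epi_map (ordering_cone c) (feasible_set a))"
    and sr: "0 \<le> s" "0 \<le> r" "s + r = 1"
  obtain b x d where v': "v = (b, x + d)" "x \<in> feasible_set a b" "d \<in> ordering_cone c"
    using v by (auto simp: gph_def epi_map_def elim!: set_plus_elim)
  obtain b' x' d' where w': "w = (b', x' + d')" "x' \<in> feasible_set a b'" "d' \<in> ordering_cone c"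
    using w by (auto simp: gph_def epi_map_def elim!: set_plus_elim)
  have "s *\<^sub>R x + r *\<^sub>R x' \<in> feasible_set a (s *\<^sub>R b + r *\<^sub>R b')"
    using v'(2) w'(2) sr
    by (auto simp: feasible_set_def inner_add_right intro!: add_mono mult_left_mono)
  moreover have "s *\<^sub>R d + r *\<^sub>R d' \<in> ordering_cone c"
    using v'(3) w'(3) sr by (auto simp: ordering_cone_def positive_polar_def inner_add_left)
  ultimately have "(s *\<^sub>R x + r *\<^sub>R x') + (s *\<^sub>R d + r *\<^sub>R d') \<in>
      epi_map (ordering_cone c) (feasible_set a) (s *\<^sub>R b + r *\<^sub>R b')"
    unfolding epi_map_def by (rule set_plus_intro)
  then show "s *\<^sub>R v + r *\<^sub>R w \<in> gph (epi_map (ordering_cone c) (feasible_set a))"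
    by (simp add: v'(1) w'(1) gph_def algebra_simps)
qed

end

theory Submission
  imports Defs
begin

text \<open>
  Both sides of the identity describe supporting inequalities.  Since the cone \<open>\<Theta>\<close> contains
  \<open>0\<close>, a pair \<open>(y, - z)\<close> with \<open>z\<close> nonnegative on \<open>\<Theta>\<close> is normal to the graph of
  \<open>b \<mapsto> F(b) + \<Theta>\<close> at \<open>(b\<^sub>0, x\<^sub>0)\<close> exactly if
  \<open>y \<bullet> (b - b\<^sub>0) \<le> z \<bullet> (x - x\<^sub>0)\<close> for all \<open>b\<close> and all feasible \<open>x \<in> F(b)\<close>.  By Farkas'
  lemma, \<open>z\<close> is nonnegative on \<open>\<Theta>\<close> exactly if \<open>z = \<Sum>i. \<alpha>\<^sub>i c\<^sub>i\<close> with \<open>\<alpha> \<ge> 0\<close>, and then the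
  right-hand side is \<open>\<alpha> \<bullet> (p - p\<^sub>0)\<close> for the objective vectors \<open>p\<close> of \<open>x\<close> and \<open>p\<^sub>0\<close> of
  \<open>x\<^sub>0\<close>.  So the two sides differ only in that one quantifies over all feasible points and the
  other over the nondominated ones.

  The gap is closed by the domination property: every feasible point of every \<open>F(b)\<close> is weakly
  dominated by a nondominated point of the same \<open>F(b)\<close>, and \<open>\<alpha> \<ge> 0\<close> makes \<open>\<alpha> \<bullet> p\<close> monotone.
  This property can fail for a general linear problem.  It holds here because a direction that
  recedes in \<open>F(b)\<close> and improves the objectives would recede in \<open>F(b\<^sub>0)\<close> too, as the recession
  cone depends on \<open>a\<close> alone, and would show \<open>x\<^sub>0\<close> to be dominated.  Without such a direction, the
  linear program that minimizes \<open>\<Sum>i. c\<^sub>i \<bullet> x\<close> over the points dominating a given one has a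
  solution, and any solution is nondominated.
\<close>

section \<open>Theorems of the alternative\<close>

lemma convex_cone_hull_range_finite:
  fixes f :: "'k::finite \<Rightarrow> 'a::real_vector"
  shows "convex_cone hull (range f) = {\<Sum>k\<in>UNIV. u k *\<^sub>R f k | u. \<forall>k. 0 \<le> u k}" (is "_ = ?R")
proof
  show "convex_cone hull (range f) \<subseteq> ?R"
  proof (rule hull_minimal)
    show "range f \<subseteq> ?R"
    proof clarify
      fix j
      have "f j = (\<Sum>k\<in>UNIV. (if k = j then 1 else 0) *\<^sub>R f k)"
        by (simp add: if_distrib [where f = "\<lambda>r. r *\<^sub>R _"] cong: if_cong)
      then show "\<exists>u. f j = (\<Sum>k\<in>UNIV. u k *\<^sub>R f k) \<and> (\<forall>k. 0 \<le> u k)"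
        by (intro exI [of _ "\<lambda>k. if k = j then 1 else 0"]) simp
    qed
    show "convex_cone ?R"
      unfolding convex_cone_iff
    proof (intro conjI ballI allI impI)
      show "0 \<in> ?R"
        by (auto intro!: exI [of _ "\<lambda>_. 0"])
    next
      fix x y assume "x \<in> ?R" "y \<in> ?R"
      then obtain u v where "x = (\<Sum>k\<in>UNIV. u k *\<^sub>R f k)" "\<forall>k. 0 \<le> u k"
        "y = (\<Sum>k\<in>UNIV. v k *\<^sub>R f k)" "\<forall>k. 0 \<le> v k"
        by auto
      then show "x + y \<in> ?R"
        by (auto simp: scaleR_add_left sum.distrib intro!: exI [of _ "\<lambda>k. u k + v k"])
    next
      fix x and r :: real assume "x \<in> ?R" "0 \<le> r"
      then obtain u where "x = (\<Sum>k\<in>UNIV. u k *\<^sub>R f k)" "\<forall>k. 0 \<le> u k"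
        by auto
      with \<open>0 \<le> r\<close> show "r *\<^sub>R x \<in> ?R"
        by (auto simp: scaleR_sum_right intro!: exI [of _ "\<lambda>k. r * u k"])
    qed
  qed
next
  have "(\<Sum>k\<in>A. u k *\<^sub>R f k) \<in> convex_cone hull (range f)" if "\<forall>k. 0 \<le> u k" for u A
    using that
    by (induction A rule: infinite_finite_induct)
      (simp_all add: convex_cone_hull_contains_0 convex_cone_hull_add convex_cone_hull_mul hull_inc)
  then show "?R \<subseteq> convex_cone hull (range f)"
    by blast
qed

text \<open>A finitely generated cone is closed, so a point outside it can be strictly separated from it;
  a linear functional that is bounded below on a cone is nonnegative on it.\<close>

lemma farkas:
  fixes f :: "'k::finite \<Rightarrow> 'a::euclidean_space"
  assumes "\<And>x. (\<And>k. 0 \<le> x \<bullet> f k) \<Longrightarrow> 0 \<le> x \<bullet> z"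
  obtains u where "\<And>k. 0 \<le> u k" "z = (\<Sum>k\<in>UNIV. u k *\<^sub>R f k)"
proof -
  let ?K = "convex_cone hull (range f)"
  have "z \<in> ?K"
  proof (rule ccontr)
    assume "z \<notin> ?K"
    then obtain x \<beta> where xz: "x \<bullet> z < \<beta>" and xK: "\<forall>y\<in>?K. \<beta> < x \<bullet> y"
      using separating_hyperplane_closed_point [of ?K z] convex_convex_cone_hull
        closed_convex_cone_hull [of "range f"] by auto
    have "\<beta> < 0"
      using xK convex_cone_hull_contains_0 [of "range f"] by force
    have "0 \<le> x \<bullet> f k" for k
    proof (rule ccontr)
      assume neg: "\<not> 0 \<le> x \<bullet> f k"
      \<comment> \<open>this multiple of the generator lies on the separating hyperplane\<close>
      have "(\<beta> / (x \<bullet> f k)) *\<^sub>R f k \<in> ?K"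
        using neg \<open>\<beta> < 0\<close> by (intro convex_cone_hull_mul hull_inc divide_nonpos_nonpos) auto
      then show False
        using xK neg by force
    qed
    then have "0 \<le> x \<bullet> z"
      by (rule assms)
    with xz \<open>\<beta> < 0\<close> show False
      by simp
  qed
  then show thesis
    using that by (auto simp: convex_cone_hull_range_finite)
qed

text \<open>Homogenization: a functional \<open>(x, s)\<close> that is nonnegative on all \<open>(a\<^sub>k, b\<^sub>k)\<close> with \<open>s > 0\<close>
  would yield the solution \<open>- x / s\<close>.  So unsolvability says that Farkas' lemma applies to these
  generators and the vector \<open>(0, - 1)\<close>.\<close>

lemma infeasible_certificate:
  fixes a :: "'k::finite \<Rightarrow> 'a::euclidean_space" and b :: "'k \<Rightarrow> real"
  assumes infeasible: "\<nexists>x. \<forall>k. a k \<bullet> x \<le> b k"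
  obtains u where "\<And>k. 0 \<le> u k" "(\<Sum>k\<in>UNIV. u k *\<^sub>R a k) = 0" "(\<Sum>k\<in>UNIV. u k * b k) < 0"
proof -
  have "0 \<le> xs \<bullet> (0, - 1)" if nonneg: "\<And>k. 0 \<le> xs \<bullet> (a k, b k)" for xs :: "'a \<times> real"
  proof (rule ccontr)
    obtain x s where xs: "xs = (x, s)"
      by fastforce
    assume "\<not> 0 \<le> xs \<bullet> (0, - 1)"
    then have "s > 0"
      by (simp add: xs)
    have "a k \<bullet> (- (1 / s) *\<^sub>R x) \<le> b k" for k
      using nonneg [of k] \<open>s > 0\<close> by (simp add: xs inner_commute field_simps)
    with infeasible show False
      by blast
  qed
  then obtain u where nonneg: "\<And>k. 0 \<le> u k" and
    eq: "(0, - 1) = (\<Sum>k\<in>UNIV. u k *\<^sub>R (a k, b k))"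
    using farkas [of "\<lambda>k. (a k, b k)" "(0, - 1)"] by metis
  have "(\<Sum>k\<in>UNIV. u k *\<^sub>R a k) = 0"
    using arg_cong [OF eq, of fst] by (simp add: fst_sum)
  moreover have "(\<Sum>k\<in>UNIV. u k * b k) = - 1"
    using arg_cong [OF eq, of snd] by (simp add: snd_sum)
  then have "(\<Sum>k\<in>UNIV. u k * b k) < 0"
    by linarith
  ultimately show thesis
    using nonneg that by blast
qed

section \<open>Existence of solutions of linear programs\<close>

text \<open>By Farkas' lemma the absence of a receding descent direction makes \<open>- w\<close> a nonnegative
  combination of the constraint vectors, which bounds the objective from below.  If the infimum
  \<open>v\<close> were not attained, the constraints together with \<open>w \<bullet> x \<le> v\<close> would be infeasible.
  In the resulting certificate the additional constraint must have positive weight, since the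
  others are feasible, and then the certificate bounds \<open>w \<bullet> x\<close> below by a number that
  exceeds \<open>v\<close>.\<close>

lemma linear_program_attains_minimum:
  fixes a :: "'k::finite \<Rightarrow> 'a::euclidean_space" and b :: "'k \<Rightarrow> real"
  assumes feasible: "\<And>k. a k \<bullet> x\<^sub>1 \<le> b k"
    and no_descent: "\<And>d. (\<And>k. a k \<bullet> d \<le> 0) \<Longrightarrow> 0 \<le> w \<bullet> d"
  obtains x where "\<And>k. a k \<bullet> x \<le> b k" "\<And>y. (\<And>k. a k \<bullet> y \<le> b k) \<Longrightarrow> w \<bullet> x \<le> w \<bullet> y"
proof -
  let ?Q = "{x. \<forall>k. a k \<bullet> x \<le> b k}"
  define v where "v = (INF x\<in>?Q. w \<bullet> x)"
  have combination_le: "(\<Sum>k\<in>UNIV. u k *\<^sub>R a k) \<bullet> y \<le> (\<Sum>k\<in>UNIV. u k * b k)"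
    if "y \<in> ?Q" "\<And>k. 0 \<le> u k" for u y
    using that by (auto simp: inner_sum_left intro!: sum_mono mult_left_mono)
  have "0 \<le> d \<bullet> (- w)" if "\<And>k. 0 \<le> d \<bullet> a k" for d
    using no_descent [of "- d"] that by (simp add: inner_commute)
  then obtain u where u: "\<And>k. 0 \<le> u k" "- w = (\<Sum>k\<in>UNIV. u k *\<^sub>R a k)"
    using farkas [of a "- w"] by metis
  have "- (\<Sum>k\<in>UNIV. u k * b k) \<le> w \<bullet> y" if "y \<in> ?Q" for y
    using combination_le [of y u] that u(1) by (simp flip: u(2))
  then have "bdd_below ((\<bullet>) w ` ?Q)"
    by (meson bdd_belowI2)
  then have v_le: "v \<le> w \<bullet> y" if "y \<in> ?Q" for y
    unfolding v_def using that by (intro cINF_lower) auto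
  have "\<exists>x. \<forall>k. case_option w a k \<bullet> x \<le> case_option v b k"
  proof (rule ccontr)
    assume "\<not> ?thesis"
    then obtain t where t: "\<And>k. 0 \<le> t k"
      "(\<Sum>k\<in>UNIV. t k *\<^sub>R case_option w a k) = 0" "(\<Sum>k\<in>UNIV. t k * case_option v b k) < 0"
      using infeasible_certificate by blast
    let ?\<beta> = "\<Sum>k\<in>UNIV. t (Some k) * b k"
    have sums: "t None *\<^sub>R w + (\<Sum>k\<in>UNIV. t (Some k) *\<^sub>R a k) = 0" "t None * v + ?\<beta> < 0"
      using t(2,3) by (simp_all add: UNIV_option_conv sum.reindex)
    have bound: "- ?\<beta> \<le> t None * (w \<bullet> y)" if "y \<in> ?Q" for y
    proof -
      have "t None * (w \<bullet> y) = - ((\<Sum>k\<in>UNIV. t (Some k) *\<^sub>R a k) \<bullet> y)"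
        using arg_cong [OF sums(1), of "\<lambda>z. z \<bullet> y"] by (simp add: inner_add_left)
      then show ?thesis
        using combination_le [of y "t \<circ> Some"] that t(1) by simp
    qed
    have "x\<^sub>1 \<in> ?Q"
      using feasible by simp
    have "t None \<noteq> 0"
      using bound [OF \<open>x\<^sub>1 \<in> ?Q\<close>] sums(2) by auto
    with t(1) [of None] have pos: "t None > 0"
      by simp
    have "(- ?\<beta>) / t None \<le> w \<bullet> y" if "y \<in> ?Q" for y
      using bound [OF that] by (simp only: pos_divide_le_eq [OF pos] mult.commute)
    then have "(- ?\<beta>) / t None \<le> v"
      unfolding v_def using \<open>x\<^sub>1 \<in> ?Q\<close> by (intro cINF_greatest) blast+
    then have "- ?\<beta> \<le> t None * v"
      by (simp only: pos_divide_le_eq [OF pos] mult.commute)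
    with sums(2) show False
      by simp
  qed
  then obtain x where x: "case_option w a k \<bullet> x \<le> case_option v b k" for k
    by blast
  show thesis
  proof (rule that)
    show "a k \<bullet> x \<le> b k" for k
      using x [of "Some k"] by simp
    show "w \<bullet> x \<le> w \<bullet> y" if "\<And>k. a k \<bullet> y \<le> b k" for y
      using x [of None] v_le [of y] that by simp
  qed
qed

section \<open>The domination property\<close>

text \<open>A direction \<open>d\<close> with \<open>a\<^sub>t \<bullet> d \<le> 0\<close> can be added to any feasible point for any right-hand
  side, in particular to \<open>x\<^sub>0\<close>; this is how a nondominated point for a single \<open>b\<^sub>0\<close> controls the
  problem for every \<open>b\<close>.\<close>

lemma nondominated_imp_no_improving_recession:
  assumes x\<^sub>0: "x\<^sub>0 \<in> nondominated_set a c b\<^sub>0"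
    and d: "\<And>t. a t \<bullet> d \<le> 0" "\<And>i. c i \<bullet> d \<le> 0"
  shows "c i \<bullet> d = 0"
proof (rule ccontr)
  assume "c i \<bullet> d \<noteq> 0"
  then have "c i \<bullet> (x\<^sub>0 + d) < c i \<bullet> x\<^sub>0"
    using d(2) [of i] by (simp add: inner_add_right)
  moreover have "x\<^sub>0 + d \<in> feasible_set a b\<^sub>0"
    using x\<^sub>0 add_mono [OF _ d(1)]
    by (fastforce simp: nondominated_set_def feasible_set_def inner_add_right)
  moreover have "\<forall>j. c j \<bullet> (x\<^sub>0 + d) \<le> c j \<bullet> x\<^sub>0"
    using d(2) by (simp add: inner_add_right)
  ultimately show False
    using x\<^sub>0 unfolding nondominated_set_def by blast
qed

lemma domination_property:
  fixes a :: "'m::finite \<Rightarrow> real^'n" and c :: "'q::finite \<Rightarrow> real^'n"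
  assumes x\<^sub>0: "x\<^sub>0 \<in> nondominated_set a c b\<^sub>0" and x: "x \<in> feasible_set a b"
  obtains x' where "x' \<in> nondominated_set a c b" "\<And>i. c i \<bullet> x' \<le> c i \<bullet> x"
proof -
  let ?A = "case_sum a c" and ?b = "case_sum (($) b) (\<lambda>i. c i \<bullet> x)" and ?w = "\<Sum>i\<in>UNIV. c i"
  have constraints: "(\<forall>k. ?A k \<bullet> y \<le> ?b k) \<longleftrightarrow>
      y \<in> feasible_set a b \<and> (\<forall>i. c i \<bullet> y \<le> c i \<bullet> x)" for y
    by (auto simp: feasible_set_def split: sum.split)
  have feasible: "?A k \<bullet> x \<le> ?b k" for k
    using x constraints [of x] by blast
  have no_descent: "0 \<le> ?w \<bullet> d" if "\<And>k. ?A k \<bullet> d \<le> 0" for d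
  proof -
    have "a t \<bullet> d \<le> 0" "c i \<bullet> d \<le> 0" for t i
      using that [of "Inl t"] that [of "Inr i"] by simp_all
    then have "c i \<bullet> d = 0" for i
      by (rule nondominated_imp_no_improving_recession [OF x\<^sub>0])
    then show ?thesis
      by (simp add: inner_sum_left)
  qed
  obtain x' where x': "\<And>k. ?A k \<bullet> x' \<le> ?b k"
    and min: "\<And>y. (\<And>k. ?A k \<bullet> y \<le> ?b k) \<Longrightarrow> ?w \<bullet> x' \<le> ?w \<bullet> y"
    using linear_program_attains_minimum [of ?A x ?b ?w, OF feasible no_descent] by blast
  have x'_feasible: "x' \<in> feasible_set a b" and x'_le: "c i \<bullet> x' \<le> c i \<bullet> x" for i
    using x' constraints [of x'] by blast+
  \<comment> \<open>all weights of \<open>?w\<close> are positive, so a point dominating \<open>x'\<close> has a smaller value\<close>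
  have "\<not> c j \<bullet> y < c j \<bullet> x'"
    if y: "y \<in> feasible_set a b" and le: "\<forall>i. c i \<bullet> y \<le> c i \<bullet> x'" for y j
  proof
    assume "c j \<bullet> y < c j \<bullet> x'"
    with le have "(\<Sum>i\<in>UNIV. c i \<bullet> y) < (\<Sum>i\<in>UNIV. c i \<bullet> x')"
      by (intro sum_strict_mono_ex1) auto
    moreover have "?w \<bullet> x' \<le> ?w \<bullet> y"
      using y le x'_le constraints [of y] by (intro min) (meson order_trans)
    ultimately show False
      by (simp add: inner_sum_left)
  qed
  then have "x' \<in> nondominated_set a c b"
    using x'_feasible unfolding nondominated_set_def by blast
  then show thesis
    using x'_le that by blast
qed

section \<open>The subdifferential of the feasible set mapping\<close>

lemma zero_in_ordering_cone: "0 \<in> ordering_cone c"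
  by (simp add: ordering_cone_def positive_polar_def)

text \<open>The ordering cone is the dual cone of the cone generated by the \<open>c\<^sub>i\<close>; Farkas' lemma is
  the statement that dualizing once more gives back that cone.\<close>

lemma normal_cone_ordering_cone_iff:
  fixes c :: "'q::finite \<Rightarrow> real^'n"
  shows "- z \<in> normal_cone 0 (ordering_cone c) \<longleftrightarrow>
    (\<exists>\<alpha> :: real^'q. (\<forall>i. 0 \<le> \<alpha> $ i) \<and> z = (\<Sum>i\<in>UNIV. \<alpha> $ i *\<^sub>R c i))"
proof
  assume z: "- z \<in> normal_cone 0 (ordering_cone c)"
  have "0 \<le> x \<bullet> z" if "\<And>i. 0 \<le> x \<bullet> c i" for x
  proof -
    have "x \<in> ordering_cone c"
      using that by (simp add: ordering_cone_def positive_polar_def)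
    then show ?thesis
      using z by (auto simp: normal_cone_def inner_commute)
  qed
  then obtain u where "\<And>i. 0 \<le> u i" "z = (\<Sum>i\<in>UNIV. u i *\<^sub>R c i)"
    using farkas [of c z] by metis
  then show "\<exists>\<alpha> :: real^'q. (\<forall>i. 0 \<le> \<alpha> $ i) \<and> z = (\<Sum>i\<in>UNIV. \<alpha> $ i *\<^sub>R c i)"
    by (intro exI [of _ "\<chi> i. u i"]) simp
next
  assume "\<exists>\<alpha> :: real^'q. (\<forall>i. 0 \<le> \<alpha> $ i) \<and> z = (\<Sum>i\<in>UNIV. \<alpha> $ i *\<^sub>R c i)"
  then show "- z \<in> normal_cone 0 (ordering_cone c)"
    by (auto simp: normal_cone_def ordering_cone_def positive_polar_def inner_sum_left
        inner_commute [of "c _"] intro!: sum_nonneg)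
qed

text \<open>A summand from the cone never decreases the pairing with \<open>z\<close>, so the normality inequality
  is tightest on the feasible points themselves.\<close>

lemma coderivative_epi_map_iff:
  assumes z: "- z \<in> normal_cone 0 \<Theta>" and zero: "0 \<in> \<Theta>"
  shows "y \<in> coderivative (epi_map \<Theta> M) b\<^sub>0 x\<^sub>0 z \<longleftrightarrow>
    (\<forall>b. \<forall>x\<in>M b. y \<bullet> (b - b\<^sub>0) \<le> z \<bullet> (x - x\<^sub>0))"
proof
  assume y: "y \<in> coderivative (epi_map \<Theta> M) b\<^sub>0 x\<^sub>0 z"
  show "\<forall>b. \<forall>x\<in>M b. y \<bullet> (b - b\<^sub>0) \<le> z \<bullet> (x - x\<^sub>0)"
  proof (intro allI ballI)
    fix b x assume "x \<in> M b"
    then have "(b, x) \<in> gph (epi_map \<Theta> M)"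
      using set_plus_intro [OF _ zero] by (fastforce simp: gph_def epi_map_def)
    then show "y \<bullet> (b - b\<^sub>0) \<le> z \<bullet> (x - x\<^sub>0)"
      using y by (auto simp: coderivative_def normal_cone_def)
  qed
next
  assume le: "\<forall>b. \<forall>x\<in>M b. y \<bullet> (b - b\<^sub>0) \<le> z \<bullet> (x - x\<^sub>0)"
  have "y \<bullet> (b - b\<^sub>0) \<le> z \<bullet> (x + d - x\<^sub>0)" if "x \<in> M b" "d \<in> \<Theta>" for b x d
  proof -
    have "y \<bullet> (b - b\<^sub>0) \<le> z \<bullet> (x - x\<^sub>0)" "0 \<le> z \<bullet> d"
      using le z that by (auto simp: normal_cone_def)
    then show ?thesis
      by (simp add: inner_add_right inner_diff_right)
  qed
  then show "y \<in> coderivative (epi_map \<Theta> M) b\<^sub>0 x\<^sub>0 z"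
    by (auto simp: coderivative_def normal_cone_def gph_def epi_map_def elim!: set_plus_elim)
qed

lemma inner_objective_vec_diff:
  fixes \<alpha> :: "real^'q"
  shows "\<alpha> \<bullet> (objective_vec c x - objective_vec c y) = (\<Sum>i\<in>UNIV. \<alpha> $ i *\<^sub>R c i) \<bullet> (x - y)"
  by (simp add: objective_vec_def inner_vec_def [of \<alpha>] inner_sum_left inner_diff_right)

text \<open>Passing from nondominated to feasible points keeps the inequality because
  \<open>\<alpha> \<bullet> objective_vec c x\<close> does not increase when \<open>x\<close> is replaced by a point that dominates it.\<close>

lemma feasible_bound_iff_pareto_bound:
  fixes a :: "'m::finite \<Rightarrow> real^'n" and c :: "'q::finite \<Rightarrow> real^'n" and \<alpha> :: "real^'q"
  assumes x\<^sub>0: "x\<^sub>0 \<in> nondominated_set a c b\<^sub>0" and \<alpha>: "\<forall>i. 0 \<le> \<alpha> $ i"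
  shows "(\<forall>b. \<forall>x\<in>feasible_set a b.
      y \<bullet> (b - b\<^sub>0) \<le> (\<Sum>i\<in>UNIV. \<alpha> $ i *\<^sub>R c i) \<bullet> (x - x\<^sub>0)) \<longleftrightarrow>
    (\<forall>(b, p)\<in>gph (pareto_front a c). y \<bullet> (b - b\<^sub>0) \<le> \<alpha> \<bullet> (p - objective_vec c x\<^sub>0))"
proof -
  let ?z = "\<Sum>i\<in>UNIV. \<alpha> $ i *\<^sub>R c i"
  have pareto: "(\<forall>(b, p)\<in>gph (pareto_front a c). y \<bullet> (b - b\<^sub>0) \<le> \<alpha> \<bullet> (p - objective_vec c x\<^sub>0))
      \<longleftrightarrow> (\<forall>b. \<forall>x\<in>nondominated_set a c b. y \<bullet> (b - b\<^sub>0) \<le> ?z \<bullet> (x - x\<^sub>0))"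
    by (force simp: gph_def pareto_front_def inner_objective_vec_diff)
  have "y \<bullet> (b - b\<^sub>0) \<le> ?z \<bullet> (x - x\<^sub>0)"
    if bound: "\<forall>b. \<forall>x\<in>nondominated_set a c b. y \<bullet> (b - b\<^sub>0) \<le> ?z \<bullet> (x - x\<^sub>0)"
      and "x \<in> feasible_set a b" for b x
  proof -
    obtain x' where x': "x' \<in> nondominated_set a c b" "\<And>i. c i \<bullet> x' \<le> c i \<bullet> x"
      using domination_property [OF x\<^sub>0 \<open>x \<in> feasible_set a b\<close>] by blast
    have "y \<bullet> (b - b\<^sub>0) \<le> ?z \<bullet> (x' - x\<^sub>0)"
      using bound x'(1) by blast
    also have "\<dots> \<le> ?z \<bullet> (x - x\<^sub>0)"
      using x'(2) \<alpha>
      by (auto simp: inner_diff_right inner_sum_left intro!: sum_mono mult_left_mono)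
    finally show ?thesis .
  qed
  then show ?thesis
    unfolding pareto by (auto simp: nondominated_set_def)
qed

theorem theorem8:
  fixes N :: "real^'n \<Rightarrow> real"
    and a :: "'m::finite \<Rightarrow> real^'n"
    and c :: "'q::finite \<Rightarrow> real^'n"
    and b\<^sub>0 :: "real^'m" and x\<^sub>0 :: "real^'n" and p\<^sub>0 :: "real^'q"
  assumes "is_norm N"
    and "(b\<^sub>0, x\<^sub>0) \<in> gph (nondominated_set a c)"
    and "p\<^sub>0 = objective_vec c x\<^sub>0"
  shows "subdifferential N (ordering_cone c) (feasible_set a) b\<^sub>0 x\<^sub>0 =
    (\<Union>\<alpha>\<in>{\<alpha> :: real^'q. (\<forall>i. 0 \<le> \<alpha> $ i) \<and> dual_norm N (\<Sum>i\<in>UNIV. \<alpha> $ i *\<^sub>R c i) = 1}.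
       {y. \<forall>(b, p)\<in>gph (pareto_front a c). y \<bullet> (b - b\<^sub>0) \<le> \<alpha> \<bullet> (p - p\<^sub>0)})"
proof -
  have x\<^sub>0: "x\<^sub>0 \<in> nondominated_set a c b\<^sub>0"
    using assms(2) by (simp add: gph_def)
  have coderivative_iff: "y \<in> coderivative (epi_map (ordering_cone c) (feasible_set a)) b\<^sub>0 x\<^sub>0
        (\<Sum>i\<in>UNIV. \<alpha> $ i *\<^sub>R c i) \<longleftrightarrow>
      (\<forall>(b, p)\<in>gph (pareto_front a c). y \<bullet> (b - b\<^sub>0) \<le> \<alpha> \<bullet> (p - p\<^sub>0))"
    if "\<forall>i. 0 \<le> \<alpha> $ i" for y and \<alpha> :: "real^'q"
  proof -
    have "- (\<Sum>i\<in>UNIV. \<alpha> $ i *\<^sub>R c i) \<in> normal_cone 0 (ordering_cone c)"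
      using that normal_cone_ordering_cone_iff by blast
    then show ?thesis
      unfolding assms(3)
      by (simp only: coderivative_epi_map_iff [OF _ zero_in_ordering_cone]
          feasible_bound_iff_pareto_bound [OF x\<^sub>0 that])
  qed
  show ?thesis
    unfolding subdifferential_def normal_cone_ordering_cone_iff
    using coderivative_iff by blast
qed

end
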